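(* Consider the matrices $$M(b_1,\dots,b_6)=\begin{pmatrix} b_1&0&-1&0&0&0\\0&b_2&-1&0&0&0\\-1&-1&b_3&-1&0&0\\0&0&-1&b_4&-1&-1\\0&0&0&-1&b_5&0\\0&0&0&-1&0&b_6\end{pmatrix},\qquad b_1,\dots,b_6\in\mathbb Z,$$ with $b_j\ge2$ for $j\in\{1,2,5,6\}$, which are positive definite and unimodular (determinant $1$). Up to equivalence there are precisely $39$ such matrices.
   Context: $M$ is the plumbing (linking) matrix of the {\tt H}-graph: the tree on vertices $1,\dots,6$ with edges $1\!-\!3$, $2\!-\!3$, $3\!-\!4$, $4\!-\!5$, $4\!-\!6$, vertex $j$ labeled by $b_j$. Two such matrices are equivalent if there is an automorphism of this graph mapping one labeling to the other; the automorphism group is generated by swapping $b_1\leftrightarrow b_2$, swapping $b_5\leftrightarrow b_6$, and the swap $(b_1,b_2,b_3,b_4,b_5,b_6)\mapsto(b_5,b_6,b_4,b_3,b_1,b_2)$. *)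

theory Defs
  imports Complex_Main "HOL-Combinatorics.Permutations" "Jordan_Normal_Form.Determinant"
begin

text \<open>
  A labeling of the vertices of the \<open>H\<close>-graph is a function \<open>b :: nat \<Rightarrow> int\<close>, of which only the
  values on the vertices \<open>1, \<dots>, 6\<close> matter. The matrix type indexes rows and columns from \<open>0\<close>,
  so vertex \<open>j\<close> belongs to row and column \<open>j - 1\<close>.
\<close>

definition H_vertices :: "nat set" where
  "H_vertices = {1..6}"

definition H_edges :: "nat set set" where
  "H_edges = {{1, 3}, {2, 3}, {3, 4}, {4, 5}, {4, 6}}"

definition H_automorphism :: "(nat \<Rightarrow> nat) \<Rightarrow> bool" where
  "H_automorphism \<sigma> \<longleftrightarrow> \<sigma> permutes H_vertices \<and> (\<lambda>e. \<sigma> ` e) ` H_edges = H_edges"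

definition H_matrix :: "(nat \<Rightarrow> int) \<Rightarrow> int mat" where
  "H_matrix b = mat_of_rows_list 6
    [[b 1,   0,  -1,   0,   0,   0],
     [  0, b 2,  -1,   0,   0,   0],
     [ -1,  -1, b 3,  -1,   0,   0],
     [  0,   0,  -1, b 4,  -1,  -1],
     [  0,   0,   0,  -1, b 5,   0],
     [  0,   0,   0,  -1,   0, b 6]]"

definition positive_definite :: "real mat \<Rightarrow> bool" where
  "positive_definite A \<longleftrightarrow>
     square_mat A \<and> transpose_mat A = A \<and>
     (\<forall>v \<in> carrier_vec (dim_row A). v \<noteq> 0\<^sub>v (dim_row A) \<longrightarrow> v \<bullet> (A *\<^sub>v v) > 0)"

definition H_matrices :: "int mat set" where
  "H_matrices =
     {H_matrix b | b.
        (\<forall>j \<in> {1, 2, 5, 6}. b j \<ge> 2) \<and>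
        positive_definite (map_mat real_of_int (H_matrix b)) \<and>
        det (H_matrix b) = 1}"

definition H_equivalence :: "(int mat \<times> int mat) set" where
  "H_equivalence =
     {(A, B). A \<in> H_matrices \<and> B \<in> H_matrices \<and>
        (\<exists>b \<sigma>. H_automorphism \<sigma> \<and> A = H_matrix b \<and> B = H_matrix (b \<circ> \<sigma>))}"

end

(*
Write x, y, c for the labels b_1, b_2, b_3 and z, w, d for b_5, b_6, b_4.  Expanding the determinant,
unimodularity reads (xyc - x - y)(zwd - z - w) = xyzw + 1, and completing squares along the leaves
shows that positive definiteness then amounts to xyc - x - y > 0.  Comparing sizes, exactly one of
c, d is 1; by symmetry let c = 1, x <= y and z <= w.  Estimating the factors
A = xy - x - y and D = dzw - z - w bounds d, x and z.  For fixed d, x, z the equation is bilinear in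
y and w; with P = (x - 1)(zd - 1) - xz it becomes f g = (xz)^2 + P for f = P w - z(x - 1) and
g = P y - x(zd - 1).  Hence f or g is at most xz + d, which leaves finitely many candidates, and
39 of them are solutions.  Equivalence classes are separated by the unordered pair of a centre label
together with the unordered pair of its leaf labels.
*)
theory Submission
  imports Defs
begin

section \<open>Determinant and positive definiteness of the plumbing matrix\<close>

text \<open>Laplace expansion along the first row in computable form: each minor is again given by a
  list of rows, so rewriting recurses down to dimension 0.\<close>

lemma det_mat_of_rows_list_Cons:
  fixes r :: "'a :: comm_ring_1 list"
  assumes "length r = Suc n" "length rs = n" "\<forall>s\<in>set rs. length s = Suc n"
  shows "det (mat_of_rows_list (Suc n) (r # rs)) =
    (\<Sum>j<Suc n. r ! j * ((-1) ^ j * det (mat_of_rows_list n (map (\<lambda>s. take j s @ drop (Suc j) s) rs))))"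
proof -
  let ?A = "mat_of_rows_list (Suc n) (r # rs)"
  have A: "?A \<in> carrier_mat (Suc n) (Suc n)"
    using assms by (auto simp: mat_of_rows_list_def)
  have "mat_delete ?A 0 j = mat_of_rows_list n (map (\<lambda>s. take j s @ drop (Suc j) s) rs)" if "j < Suc n" for j
    using assms that
    by (intro eq_matI) (auto simp: mat_delete_def mat_of_rows_list_def nth_append min_def)
  then show ?thesis
    unfolding laplace_expansion_row[OF A zero_less_Suc]
    using assms by (intro sum.cong) (auto simp: cofactor_def mat_of_rows_list_def)
qed

lemma det_mat_of_rows_list_Nil: "det (mat_of_rows_list 0 []) = (1 :: 'a :: comm_ring_1)"
  by (intro det_dim_zero) (simp add: mat_of_rows_list_def)

text \<open>Cutting the edge between the centres 3 and 4 gives the product of the determinants of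
  the two stars, minus the determinant left when both centres are deleted.\<close>

lemma det_H_matrix:
  "det (H_matrix b) = (b 1 * b 2 * b 3 - b 1 - b 2) * (b 4 * b 5 * b 6 - b 5 - b 6) - b 1 * b 2 * b 5 * b 6"
  unfolding H_matrix_def numeral_eq_Suc[of "Num.num.Bit0 _"]
  by (simp add: det_mat_of_rows_list_Cons det_mat_of_rows_list_Nil numeral_eq_Suc lessThan_Suc)
    (simp add: algebra_simps)

lemma quadratic_form_H_matrix:
  assumes "v \<in> carrier_vec 6"
  shows "v \<bullet> (map_mat real_of_int (H_matrix b) *\<^sub>v v) =
    b 1 * (v $ 0)\<^sup>2 + b 2 * (v $ 1)\<^sup>2 + b 3 * (v $ 2)\<^sup>2 + b 4 * (v $ 3)\<^sup>2 + b 5 * (v $ 4)\<^sup>2 + b 6 * (v $ 5)\<^sup>2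
    - 2 * (v $ 2) * (v $ 0 + v $ 1 + v $ 3) - 2 * (v $ 3) * (v $ 4 + v $ 5)"
proof -
  have 6: "{0..<6} = {0, 1, 2, 3, 4, 5::nat}" by auto
  show ?thesis using assms
    by (simp add: scalar_prod_def 6 H_matrix_def mat_of_rows_list_def)
      (simp add: algebra_simps power2_eq_square numeral_eq_Suc)
qed

text \<open>Completing squares at the four leaves leaves the binary form
  \<open>P * r\<^sup>2 - 2 * r * s + R * s\<^sup>2\<close>, positive definite because
  \<open>P > 0\<close> and \<open>P * R > 1\<close>.\<close>

lemma quadratic_form_pos:
  fixes x y c d z w :: real
  assumes "x > 0" "y > 0" "z > 0" "w > 0" and C: "x * y * c - x - y > 0"
    and det: "(x * y * c - x - y) * (d * z * w - z - w) - x * y * z * w > 0"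
    and nz: "p \<noteq> 0 \<or> q \<noteq> 0 \<or> r \<noteq> 0 \<or> s \<noteq> 0 \<or> t \<noteq> 0 \<or> u \<noteq> 0"
  shows "x * p\<^sup>2 + y * q\<^sup>2 + c * r\<^sup>2 + d * s\<^sup>2 + z * t\<^sup>2 + w * u\<^sup>2
    - 2 * r * (p + q + s) - 2 * s * (t + u) > 0" (is "?Q > 0")
proof -
  \<comment> \<open>The centre labels that remain once the leaves are eliminated (Schur
    complements).\<close>
  define P where "P = c - 1 / x - 1 / y"
  define R where "R = d - 1 / z - 1 / w"
  have C': "x * y * c - x - y = x * y * P" and D': "d * z * w - z - w = z * w * R"
    using assms by (simp_all add: P_def R_def field_simps)
  have P: "P > 0" using C assms(1,2) unfolding C' by (simp add: zero_less_mult_iff mult_less_0_iff)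
  have "x * y * z * w * (P * R - 1) > 0" using det unfolding C' D' by (simp add: algebra_simps)
  then have "P * R - 1 > 0" using assms(1-4) by (simp add: zero_less_mult_iff mult_less_0_iff)
  then have PR: "P * R > 1" by simp
  define L where "L = x * (p - r / x)\<^sup>2 + y * (q - r / y)\<^sup>2 + z * (t - s / z)\<^sup>2 + w * (u - s / w)\<^sup>2"
  have Q: "P * ?Q = P * L + (P * r - s)\<^sup>2 + (P * R - 1) * s\<^sup>2"
    using assms(1-4) unfolding P_def R_def L_def by (simp add: field_simps power2_eq_square)
  have L: "L \<ge> 0" unfolding L_def using assms(1-4) by simp
  have "P * ?Q > 0"
  \<comment> \<open>If both centre coordinates vanish, positivity must come from the leaves;
    otherwise the binary form supplies it.\<close>
  proof (cases "r = 0 \<and> s = 0")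
    case True
    then have "x * p\<^sup>2 > 0 \<or> y * q\<^sup>2 > 0 \<or> z * t\<^sup>2 > 0 \<or> w * u\<^sup>2 > 0"
      using nz assms(1-4) by auto
    moreover have "x * p\<^sup>2 \<ge> 0" "y * q\<^sup>2 \<ge> 0" "z * t\<^sup>2 \<ge> 0" "w * u\<^sup>2 \<ge> 0"
      using assms(1-4) by simp_all
    ultimately have "x * p\<^sup>2 + y * q\<^sup>2 + z * t\<^sup>2 + w * u\<^sup>2 > 0" by linarith
    then have "L > 0" using True by (simp add: L_def)
    then show ?thesis unfolding Q using True P by simp
  next
    case False
    then have "(P * r - s)\<^sup>2 + (P * R - 1) * s\<^sup>2 > 0"
      using P PR by (cases "s = 0") (auto intro: add_nonneg_pos)
    then show ?thesis unfolding Q using L P by (simp add: add_nonneg_pos add.assoc)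
  qed
  then show ?thesis using P by (simp add: zero_less_mult_iff)
qed

text \<open>This is Sylvester's criterion for the vertex order 1, 2, 5, 6, 3, 4: the first four
  minors are products of leaf labels, the fifth is \<open>b 5 * b 6\<close> times the tested
  quantity, the last is 1.\<close>

lemma positive_definite_H_matrix_iff:
  assumes leaves: "\<forall>j \<in> {1, 2, 5, 6}. b j \<ge> 2"
    and det: "(b 1 * b 2 * b 3 - b 1 - b 2) * (b 4 * b 5 * b 6 - b 5 - b 6) - b 1 * b 2 * b 5 * b 6 = 1"
  shows "positive_definite (map_mat real_of_int (H_matrix b)) \<longleftrightarrow> b 1 * b 2 * b 3 - b 1 - b 2 > 0"
    (is "positive_definite ?M \<longleftrightarrow> _")
proof
  have dim: "dim_row (H_matrix b) = 6" "dim_col (H_matrix b) = 6"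
    by (simp_all add: H_matrix_def mat_of_rows_list_def)
  have pos: "b 1 > 0" "b 2 > 0" "b 5 > 0" "b 6 > 0" using leaves by auto
  {
    assume "positive_definite ?M"
    \<comment> \<open>Among vectors with entry 1 at vertex 3 and 0 at vertices 4, 5, 6, this one
      minimises the form; the minimum is \<open>b 3 - 1 / b 1 - 1 / b 2\<close>.\<close>
    define v where "v = vec 6 ((!) [1 / b 1, 1 / b 2, 1 :: real, 0, 0, 0])"
    have v: "v \<in> carrier_vec 6" by (simp add: v_def)
    have v_nth: "v $ i = [1 / b 1, 1 / b 2, 1 :: real, 0, 0, 0] ! i" if "i < 6" for i
      using that by (simp add: v_def)
    have "v $ 2 \<noteq> 0\<^sub>v 6 $ 2" by (simp add: v_nth)
    then have "v \<noteq> 0\<^sub>v 6" by metis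
    then have "v \<bullet> (?M *\<^sub>v v) > 0"
      using \<open>positive_definite ?M\<close> v by (simp add: positive_definite_def dim)
    then have "real_of_int (b 3) - 1 / b 1 - 1 / b 2 > 0"
      unfolding quadratic_form_H_matrix[OF v] using pos by (simp add: v_nth power2_eq_square)
    then have "real_of_int (b 1) * b 2 * (b 3 - 1 / b 1 - 1 / b 2) > 0"
      using pos by simp
    also have "real_of_int (b 1) * b 2 * (b 3 - 1 / b 1 - 1 / b 2) = real_of_int (b 1 * b 2 * b 3 - b 1 - b 2)"
      using pos by (simp add: field_simps)
    finally show "b 1 * b 2 * b 3 - b 1 - b 2 > 0" by linarith
  }
  {
    assume C: "b 1 * b 2 * b 3 - b 1 - b 2 > 0"
    have C': "real_of_int (b 1) * b 2 * b 3 - b 1 - b 2 > 0"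
      using C by (metis of_int_0_less_iff of_int_diff of_int_mult)
    have "real_of_int ((b 1 * b 2 * b 3 - b 1 - b 2) * (b 4 * b 5 * b 6 - b 5 - b 6) - b 1 * b 2 * b 5 * b 6) > 0"
      unfolding det by simp
    then have D': "(real_of_int (b 1) * b 2 * b 3 - b 1 - b 2) * (real_of_int (b 4) * b 5 * b 6 - b 5 - b 6)
        - real_of_int (b 1) * b 2 * b 5 * b 6 > 0"
      by simp
    have "v \<bullet> (?M *\<^sub>v v) > 0" if v: "v \<in> carrier_vec 6" and nz: "v \<noteq> 0\<^sub>v 6" for v
    proof -
      have "\<exists>i<6. v $ i \<noteq> 0" using v nz by (metis carrier_vecD eq_vecI index_zero_vec)
      then have "v $ 0 \<noteq> 0 \<or> v $ 1 \<noteq> 0 \<or> v $ 2 \<noteq> 0 \<or> v $ 3 \<noteq> 0 \<or> v $ 4 \<noteq> 0 \<or> v $ 5 \<noteq> 0"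
        by (auto simp: less_Suc_eq numeral_eq_Suc)
      from quadratic_form_pos[OF _ _ _ _ C' D' this] show ?thesis
        unfolding quadratic_form_H_matrix[OF v] using pos by simp
    qed
    moreover have "transpose_mat ?M = ?M"
      by (intro eq_matI) (auto simp: H_matrix_def mat_of_rows_list_def less_Suc_eq numeral_eq_Suc)
    ultimately show "positive_definite ?M"
      by (simp add: positive_definite_def dim)
  }
qed

section \<open>Bounds on \<open>d\<close>, \<open>x\<close> and \<open>z\<close> when one centre has
  label 1\<close>

text \<open>The worst case is \<open>(2, 3)\<close>, where \<open>1 / x + 1 / y\<close> is 5/6; from
  \<open>x = 3\<close> on this sum is at most 2/3.\<close>

lemma six_mult_le:
  fixes x y :: int
  assumes "2 \<le> x" "x \<le> y" "x + y < x * y"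
  shows "6 * (x + y) \<le> 5 * (x * y)"
proof (cases "x = 2")
  case False
  with assms have "3 \<le> x" by simp
  then have "3 * y \<le> x * y" using assms by (intro mult_right_mono) auto
  then have "15 * y \<le> 5 * (x * y)" by simp
  moreover have "6 * (x + y) \<le> 15 * y" using assms by simp
  ultimately show ?thesis by (rule order_trans[rotated])
qed (use assms in auto)

text \<open>After division by \<open>x * y * z * w\<close>, the product of
  \<open>1 - 1 / x - 1 / y\<close> and \<open>d - 1 / z - 1 / w\<close> barely exceeds 1; large
  \<open>d\<close>, \<open>x\<close> or \<open>z\<close> make it too big.\<close>

lemma equation_bounds:
  fixes d x y z w :: int
  assumes bounds: "2 \<le> d" "2 \<le> x" "x \<le> y" "2 \<le> z" "z \<le> w"
    and A: "x + y < x * y"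
    and eq: "(x * y - x - y) * (d * z * w - z - w) = x * y * z * w + 1"
  shows "d \<le> 7" "x \<le> (if d = 2 then 14 else 4)" "z \<le> (if d = 2 then 22 else 10)"
proof -
  define A D where "A = x * y - x - y" and "D = d * z * w - z - w"
  have AD: "A * D = x * y * z * w + 1" using eq by (simp add: A_def D_def)
  have "A > 0" using assms by (simp add: A_def)
  have xy: "x * y \<ge> 6" 
  proof (cases "x = 2")
    case True then show ?thesis using assms by simp
  next
    case False
    then have "3 * 2 \<le> x * y" using bounds by (intro mult_mono) auto
    then show ?thesis by simp
  qed
  have zw: "z * w \<ge> 4" using mult_mono[of 2 z 2 w] bounds by simp
  have zw': "z + w \<le> z * w"
  proof -
    have "0 \<le> (z - 2) * (w - 1) + (w - 2)" using bounds by simp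
    then show ?thesis by (simp add: algebra_simps)
  qed
  have D_ge: "(d - 1) * (z * w) \<le> D"
    using zw' by (simp add: D_def algebra_simps)
  have "0 < (d - 1) * (z * w)" using bounds by simp
  then have "D > 0" using D_ge by simp
  have A_ge: "x * y \<le> 6 * A" using six_mult_le[OF bounds(2,3) A] by (simp add: A_def)
  show d: "d \<le> 7"
  proof (rule ccontr)
    \<comment> \<open>Now \<open>A * D\<close> is at least 7/6 of \<open>x * y * z * w\<close>, yet
      exceeds it by only 1, so \<open>x * y * z * w \<le> 6\<close>.\<close>
    assume "\<not> d \<le> 7"
    then have "7 * (z * w) \<le> (d - 1) * (z * w)" using zw by (intro mult_right_mono) auto
    then have "7 * (z * w) \<le> D" using D_ge by simp
    then have "(x * y) * (7 * (z * w)) \<le> (6 * A) * D"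
      using mult_mono[of "x * y" "6 * A" "7 * (z * w)" D] A_ge xy zw \<open>A > 0\<close> by simp
    then have "x * y * (z * w) \<le> 6" using AD by (simp add: algebra_simps)
    moreover have "6 * 4 \<le> x * y * (z * w)" using mult_mono[of 6 "x * y" 4 "z * w"] xy zw by simp
    ultimately show False by simp
  qed
  have x_D: "(x - 2) * D \<le> x * (z * w)"
  proof -
    have "y * (x - 2) \<le> A" using bounds by (simp add: A_def algebra_simps)
    then have "y * (x - 2) * D \<le> A * D" using \<open>D > 0\<close> by simp
    \<comment> \<open>The 1 is the excess of \<open>A * D\<close> over \<open>x * y * z * w\<close>;
      as \<open>y \<ge> 2\<close>, a multiple of \<open>y\<close> that is at most 1 is at most
      0.\<close>
    then have "y * ((x - 2) * D - x * (z * w)) \<le> 1" unfolding AD by (simp add: algebra_simps)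
    moreover have "2 \<le> y * ((x - 2) * D - x * (z * w))" if "(x - 2) * D - x * (z * w) \<ge> 1"
      using mult_mono[of 2 y 1 "(x - 2) * D - x * (z * w)"] bounds that by simp
    ultimately show ?thesis by linarith
  qed
  show x: "x \<le> (if d = 2 then 14 else 4)"
  proof (cases "d = 2")
    case True
    \<comment> \<open>Equality would force \<open>z = w = 2\<close> and \<open>D = 4\<close>, making
      1 a multiple of 4. Strictness yields \<open>7 * (z * w) \<le> 6 * D\<close>, whence the bound
      14.\<close>
    have "z + w \<noteq> z * w"
    proof
      assume "z + w = z * w"
      moreover have "(z - 2) * (w - 1) + (w - 2) = z * w - (z + w)" by (simp add: algebra_simps)
      moreover have "(z - 2) * (w - 1) \<ge> 0" using bounds by simp
      ultimately have "w = 2" using bounds by linarith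
      with bounds have "D = 4" "z = 2" using True by (auto simp: D_def)
      then have "4 * (A - x * y) = 1" using AD \<open>w = 2\<close> by (simp add: algebra_simps)
      then show False by presburger
    qed
    then have "6 * (z + w) \<le> 5 * (z * w)" using zw' bounds by (intro six_mult_le) auto
    then have "7 * (z * w) \<le> 6 * D" by (simp add: D_def True algebra_simps)
    then have "(x - 2) * (7 * (z * w)) \<le> (x - 2) * (6 * D)" using bounds by (intro mult_left_mono) auto
    also have "\<dots> \<le> 6 * (x * (z * w))" using x_D by simp
    finally have "(z * w) * (x - 14) \<le> 0" by (simp add: algebra_simps)
    then show ?thesis using zw bounds True by (simp add: mult_le_0_iff)
  next
    case False
    then have "2 * (z * w) \<le> (d - 1) * (z * w)" using zw bounds by (intro mult_right_mono) auto
    then have "2 * (z * w) \<le> D" using D_ge by simp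
    then have "(x - 2) * (2 * (z * w)) \<le> (x - 2) * D" using bounds by (intro mult_left_mono) auto
    also have "\<dots> \<le> x * (z * w)" using x_D .
    finally have "(z * w) * (x - 4) \<le> 0" by (simp add: algebra_simps)
    then show ?thesis using zw bounds False by (simp add: mult_le_0_iff)
  qed
  \<comment> \<open>The equation reads \<open>k * z * w = A * (z + w) + 1\<close>; thus
    \<open>k > 0\<close>, and \<open>z \<le> w\<close> bounds \<open>z * k\<close> by
    \<open>2 * A\<close>.\<close>
  define k where "k = A * d - x * y"
  have "z * k \<le> 2 * A"
  proof -
    have "w * (d * z - 2) \<le> D" using bounds by (simp add: D_def algebra_simps)
    then have "A * (w * (d * z - 2)) \<le> A * D" using \<open>A > 0\<close> by simp
    then have "w * (z * k - 2 * A) \<le> 1" unfolding AD by (simp add: k_def algebra_simps)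
    moreover have "2 \<le> w * (z * k - 2 * A)" if "z * k - 2 * A \<ge> 1"
      using mult_mono[of 2 w 1 "z * k - 2 * A"] bounds that by simp
    ultimately show ?thesis by linarith
  qed
  have "k \<ge> 1"
  proof -
    have "A * D \<le> A * (d * (z * w))" using bounds \<open>A > 0\<close> by (intro mult_left_mono) (auto simp: D_def)
    then have "(z * w) * k > 0" unfolding AD by (simp add: k_def algebra_simps)
    then show ?thesis using zw by (simp add: zero_less_mult_iff)
  qed
  \<comment> \<open>The ratio \<open>A / k\<close> peaks at 11 for \<open>d = 2\<close>,
    \<open>(x, y) = (3, 7)\<close>, and at 5 for \<open>d = 3\<close>,
    \<open>(x, y) = (2, 7)\<close>.\<close>
  have "A \<le> (if d = 2 then 11 else 5) * k"
  proof (cases "d = 2")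
    case True
    have "x \<noteq> 2" using \<open>k \<ge> 1\<close> by (auto simp: k_def A_def True)
    then have "0 \<le> (x - 3) * (y - x) + (x - 3) * (x - 3)" using bounds by simp
    then show ?thesis using \<open>k \<ge> 1\<close> unfolding k_def A_def True by (simp add: algebra_simps)
  next
    case False
    then have "d = 3 \<or> d = 4 \<or> d = 5 \<or> d = 6 \<or> d = 7" "x = 2 \<or> x = 3 \<or> x = 4"
      using d x bounds by auto
    then show ?thesis using \<open>k \<ge> 1\<close> bounds unfolding k_def A_def by auto
  qed
  then have "z * k \<le> (if d = 2 then 22 else 10) * k"
    using \<open>z * k \<le> 2 * A\<close> by auto
  then show "z \<le> (if d = 2 then 22 else 10)" using \<open>k \<ge> 1\<close> by simp
qed

section \<open>The list of solutions and the finite search\<close>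

text \<open>Entries are \<open>(d, x, y, z, w)\<close>: the centre with leaves
  \<open>x \<le> y\<close> has label 1, the one with leaves \<open>z \<le> w\<close> has label
  \<open>d\<close>.\<close>

definition H_solutions :: "(int \<times> int \<times> int \<times> int \<times> int) list" where
  "H_solutions =
    [(2, 3, 7, 12, 133), (2, 3, 7, 13, 72), (2, 3, 8, 7, 92), (2, 3, 8, 8, 35), (2, 3, 8, 11, 16),
     (2, 3, 11, 4, 77), (2, 3, 11, 5, 16), (2, 3, 16, 3, 88), (2, 3, 17, 3, 47), (2, 3, 47, 4, 5),
     (2, 3, 56, 3, 8), (2, 3, 97, 3, 7), (2, 4, 5, 6, 67), (2, 4, 5, 7, 26), (2, 4, 7, 3, 52),
     (2, 4, 9, 3, 10), (2, 4, 13, 2, 71), (2, 4, 17, 2, 19), (2, 4, 23, 3, 4), (2, 4, 25, 2, 11),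
     (2, 4, 77, 2, 7), (2, 5, 7, 3, 7), (2, 5, 8, 2, 55), (2, 5, 9, 2, 21), (2, 5, 16, 2, 7),
     (2, 5, 33, 2, 5), (2, 8, 57, 2, 3), (2, 9, 32, 2, 3), (2, 12, 17, 2, 3), (3, 2, 7, 6, 31),
     (3, 2, 7, 7, 18), (3, 2, 9, 3, 11), (3, 2, 11, 2, 19), (3, 2, 27, 2, 3), (3, 3, 4, 2, 11),
     (3, 3, 4, 3, 4), (3, 3, 5, 2, 3), (4, 2, 5, 2, 7), (7, 2, 3, 2, 3)]"

text \<open>
  For fixed \<open>d, x, z, w\<close> the only candidate for \<open>y\<close> is \<open>n div f\<close>, because the equation is
  equivalent to \<open>y * f = n\<close>; dually for \<open>w\<close> and \<open>g\<close>.
\<close>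

definition H_test_w :: "int \<Rightarrow> int \<Rightarrow> int \<Rightarrow> int \<Rightarrow> int \<Rightarrow> bool" where
  "H_test_w d x z P w \<longleftrightarrow> (let f = P * w - z * (x - 1); n = 1 + x * (d * z * w - z - w); y = n div f in
     y * f = n \<longrightarrow> x \<le> y \<longrightarrow> (d, x, y, z, w) \<in> set H_solutions)"

definition H_test_y :: "int \<Rightarrow> int \<Rightarrow> int \<Rightarrow> int \<Rightarrow> int \<Rightarrow> bool" where
  "H_test_y d x z P y \<longleftrightarrow> (let g = P * y - x * (z * d - 1); n = 1 + z * (x * y - x - y); w = n div g in
     w * g = n \<longrightarrow> z \<le> w \<longrightarrow> (d, x, y, z, w) \<in> set H_solutions)"

text \<open>The ranges are \<open>f \<le> x * z + d\<close> and \<open>g \<le> x * z + d\<close>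
  solved for \<open>w\<close> and \<open>y\<close>; for \<open>P \<le> 0\<close> the factor
  \<open>f\<close> could not be positive.\<close>

definition H_search :: "int \<Rightarrow> int \<Rightarrow> int \<Rightarrow> bool" where
  "H_search d x z \<longleftrightarrow> (let P = (x - 1) * (z * d - 1) - x * z in P > 0 \<longrightarrow>
     (\<forall>w\<in>set [z..(x * z + d + z * (x - 1)) div P]. H_test_w d x z P w) \<and>
     (\<forall>y\<in>set [x..(x * z + d + x * (z * d - 1)) div P]. H_test_y d x z P y))"

lemma H_search:
  "\<forall>d\<in>set [2..7]. \<forall>x\<in>set [2..if d = 2 then 14 else 4]. \<forall>z\<in>set [2..if d = 2 then 22 else 10].
    H_search d x z"
  \<comment> \<open>The definitions are unfolded in stages, so that each body is evaluated only on numerals.\<close>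
  by (simp del: set_upto, simp add: H_search_def Let_def del: set_upto,
      simp add: H_test_w_def H_test_y_def Let_def, simp add: H_solutions_def)

section \<open>Equivalence as equality of profiles\<close>

text \<open>
  As \<open>{x, y}\<close> has two elements or one, it determines the multiset of the two leaf labels.
\<close>

definition profile :: "int mat \<Rightarrow> (int \<times> int set) set" where
  "profile A = {(A $$ (2, 2), {A $$ (0, 0), A $$ (1, 1)}), (A $$ (3, 3), {A $$ (4, 4), A $$ (5, 5)})}"

lemma profile_H_matrix: "profile (H_matrix b) = {(b 3, {b 1, b 2}), (b 4, {b 5, b 6})}"
  by (simp add: profile_def H_matrix_def mat_of_rows_list_def)

lemma H_automorphism_id: "H_automorphism id"
  by (simp add: H_automorphism_def permutes_id)

lemma H_automorphism_comp:
  assumes "H_automorphism \<sigma>" "H_automorphism \<tau>"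
  shows "H_automorphism (\<sigma> \<circ> \<tau>)"
proof -
  have "(\<lambda>e. (\<sigma> \<circ> \<tau>) ` e) ` H_edges = (\<lambda>e. \<sigma> ` e) ` (\<lambda>e. \<tau> ` e) ` H_edges"
    by (simp add: image_image image_comp)
  with assms show ?thesis by (auto simp: H_automorphism_def intro: permutes_compose)
qed

lemma H_automorphism_swap_1_2: "H_automorphism (transpose 1 2)"
  and H_automorphism_swap_5_6: "H_automorphism (transpose 5 6)"
  by (auto simp: H_automorphism_def H_vertices_def H_edges_def transpose_def intro!: permutes_swap_id)

lemma H_automorphism_flip: "H_automorphism (transpose 1 5 \<circ> transpose 2 6 \<circ> transpose 3 4)"
proof -
  have "transpose 1 5 \<circ> transpose 2 6 \<circ> transpose 3 4 permutes H_vertices"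
    by (intro permutes_compose permutes_swap_id) (auto simp: H_vertices_def)
  then show ?thesis
    by (simp add: H_automorphism_def H_edges_def transpose_def insert_commute)
qed

text \<open>Vertices 3 and 4 are the only ones of degree three, so they are fixed or exchanged, and
  each takes its leaves along.\<close>

lemma H_automorphism_cases:
  assumes "H_automorphism \<sigma>"
  shows "\<sigma> 3 = 3 \<and> \<sigma> 4 = 4 \<and> {\<sigma> 1, \<sigma> 2} = {1, 2} \<and> {\<sigma> 5, \<sigma> 6} = {5, 6} \<or>
    \<sigma> 3 = 4 \<and> \<sigma> 4 = 3 \<and> {\<sigma> 1, \<sigma> 2} = {5, 6} \<and> {\<sigma> 5, \<sigma> 6} = {1, 2}"
proof -
  have perm: "\<sigma> permutes {1..6}" and edges: "(\<lambda>e. \<sigma> ` e) ` H_edges = H_edges"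
    using assms by (auto simp: H_automorphism_def H_vertices_def)
  have neq: "\<sigma> i \<noteq> \<sigma> j" if "i \<noteq> j" for i j
    using permutes_inj[OF perm] that by (auto dest: injD)
  have edge: "{\<sigma> i, \<sigma> j} \<in> H_edges" if "{i, j} \<in> H_edges" for i j
    using imageI[OF that, of "\<lambda>e. \<sigma> ` e"] edges by simp
  have e: "{\<sigma> 1, \<sigma> 3} \<in> H_edges" "{\<sigma> 2, \<sigma> 3} \<in> H_edges" "{\<sigma> 3, \<sigma> 4} \<in> H_edges"
    "{\<sigma> 4, \<sigma> 5} \<in> H_edges" "{\<sigma> 4, \<sigma> 6} \<in> H_edges"
    by (rule edge; simp add: H_edges_def)+
  have "\<sigma> 3 = 3 \<or> \<sigma> 3 = 4"
    using e(1-3) neq[of 1 2] neq[of 1 4] neq[of 2 4] by (auto simp: H_edges_def doubleton_eq_iff)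
  moreover have "\<sigma> 4 = 3 \<or> \<sigma> 4 = 4"
    using e(3-5) neq[of 3 5] neq[of 3 6] neq[of 5 6] by (auto simp: H_edges_def doubleton_eq_iff)
  ultimately consider "\<sigma> 3 = 3" "\<sigma> 4 = 4" | "\<sigma> 3 = 4" "\<sigma> 4 = 3" using neq[of 3 4] by auto
  then show ?thesis
  proof cases
    case 1
    then show ?thesis using e neq[of 1 2] neq[of 1 4] neq[of 2 4] neq[of 3 5] neq[of 3 6] neq[of 5 6]
      by (simp add: H_edges_def doubleton_eq_iff) (elim disjE; simp)
  next
    case 2
    then show ?thesis using e neq[of 1 2] neq[of 1 4] neq[of 2 4] neq[of 3 5] neq[of 3 6] neq[of 5 6]
      by (simp add: H_edges_def doubleton_eq_iff) (elim disjE; simp)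
  qed
qed

lemma profile_H_automorphism:
  assumes "H_automorphism \<sigma>"
  shows "profile (H_matrix (b \<circ> \<sigma>)) = profile (H_matrix b)"
proof -
  have *: "{b i, b j} = b ` {i, j}" for i j by simp
  show ?thesis
    using H_automorphism_cases[OF assms]
    by (elim disjE conjE) (simp_all add: profile_H_matrix * insert_commute del: image_insert)
qed

text \<open>With the centres matched only leaf swaps remain; comparing one leaf label at each end
  decides whether to swap there.\<close>

lemma H_automorphism_of_ends:
  assumes "b' 3 = b 3" "b' 4 = b 4" "{b' 1, b' 2} = {b 1, b 2}" "{b' 5, b' 6} = {b 5, b 6}"
  shows "\<exists>\<sigma>. H_automorphism \<sigma> \<and> H_matrix b' = H_matrix (b \<circ> \<sigma>)"
proof -
  define \<tau> where "\<tau> = (if b' 1 = b 1 then id else transpose 1 (2::nat))"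
  define \<rho> where "\<rho> = (if b' 5 = b 5 then id else transpose 5 (6::nat))"
  have "H_automorphism (\<tau> \<circ> \<rho>)"
    by (intro H_automorphism_comp)
      (simp_all add: \<tau>_def \<rho>_def H_automorphism_id H_automorphism_swap_1_2
        H_automorphism_swap_5_6 del: One_nat_def)
  moreover have "H_matrix b' = H_matrix (b \<circ> (\<tau> \<circ> \<rho>))"
    using assms by (auto simp: H_matrix_def \<tau>_def \<rho>_def transpose_def doubleton_eq_iff)
  ultimately show ?thesis by blast
qed

lemma H_automorphism_of_profile:
  assumes "profile (H_matrix b') = profile (H_matrix b)"
  shows "\<exists>\<sigma>. H_automorphism \<sigma> \<and> H_matrix b' = H_matrix (b \<circ> \<sigma>)"
proof -
  let ?\<phi> = "transpose 1 5 \<circ> transpose 2 6 \<circ> transpose 3 (4::nat)"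
  have \<phi>: "?\<phi> 1 = 5" "?\<phi> 2 = 6" "?\<phi> 3 = 4" "?\<phi> 4 = 3" "?\<phi> 5 = 1" "?\<phi> 6 = 2"
    by (simp_all add: transpose_def)
  consider "b' 3 = b 3" "b' 4 = b 4" "{b' 1, b' 2} = {b 1, b 2}" "{b' 5, b' 6} = {b 5, b 6}"
    | "b' 3 = b 4" "b' 4 = b 3" "{b' 1, b' 2} = {b 5, b 6}" "{b' 5, b' 6} = {b 1, b 2}"
    using assms unfolding profile_H_matrix by (subst (asm) doubleton_eq_iff) auto
  then show ?thesis
  proof cases
    case 1
    then show ?thesis by (rule H_automorphism_of_ends)
  next
    case 2
    \<comment> \<open>Composing with the flip exchanges the two ends of \<open>b\<close>, which
      reduces this to the matched situation.\<close>
    then have "\<exists>\<sigma>. H_automorphism \<sigma> \<and> H_matrix b' = H_matrix ((b \<circ> ?\<phi>) \<circ> \<sigma>)"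
      by (intro H_automorphism_of_ends) (simp_all only: comp_apply[of b] \<phi>)
    then show ?thesis
      using H_automorphism_comp[OF H_automorphism_flip] by (metis comp_assoc)
  qed
qed

text \<open>Exhibits the equivalence as the kernel of \<open>profile\<close>, so that classes can be
  counted as profiles.\<close>

lemma H_equivalence_iff:
  "(A, B) \<in> H_equivalence \<longleftrightarrow> A \<in> H_matrices \<and> B \<in> H_matrices \<and> profile A = profile B"
proof
  assume "(A, B) \<in> H_equivalence"
  then show "A \<in> H_matrices \<and> B \<in> H_matrices \<and> profile A = profile B"
    by (auto simp: H_equivalence_def profile_H_automorphism)
next
  assume *: "A \<in> H_matrices \<and> B \<in> H_matrices \<and> profile A = profile B"
  then obtain b b' where "A = H_matrix b" "B = H_matrix b'" by (auto simp: H_matrices_def)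
  with * H_automorphism_of_profile[of b' b] show "(A, B) \<in> H_equivalence"
    by (auto simp: H_equivalence_def)
qed

text \<open>The classes are the fibres of \<open>f\<close>, and nonempty fibres over distinct values
  are distinct.\<close>

lemma card_quotient_kernel:
  "card (S // {(a, b). a \<in> S \<and> b \<in> S \<and> f a = f b}) = card (f ` S)"
(is "card (S // ?E) = _")
proof -
  have "S // ?E = (\<lambda>x. ?E `` {x}) ` S" by (auto simp: quotient_def)
  also have "\<dots> = (\<lambda>x. {a \<in> S. f a = f x}) ` S" by (intro image_cong refl) auto
  finally have "S // ?E = (\<lambda>c. {a \<in> S. f a = c}) ` f ` S" by (simp add: image_image)
  moreover have "inj_on (\<lambda>c. {a \<in> S. f a = c}) (f ` S)"
    by (auto simp: inj_on_def)
  ultimately show ?thesis by (simp add: card_image)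
qed

section \<open>Completeness and soundness of the list\<close>

lemma equation_imp_H_solutions:
  fixes d x y z w :: int
  assumes bounds: "2 \<le> d" "2 \<le> x" "x \<le> y" "2 \<le> z" "z \<le> w"
    and A: "x + y < x * y"
    and eq: "(x * y - x - y) * (d * z * w - z - w) = x * y * z * w + 1"
  shows "(d, x, y, z, w) \<in> set H_solutions"
proof -
  \<comment> \<open>In the equation, \<open>P\<close> is the coefficient of \<open>y * w\<close>,
    \<open>f\<close> that of \<open>y\<close> for fixed \<open>w\<close>, and \<open>g\<close> that
    of \<open>w\<close> for fixed \<open>y\<close>.\<close>
  define P where "P = (x - 1) * (z * d - 1) - x * z"
  define f g where "f = P * w - z * (x - 1)" and "g = P * y - x * (z * d - 1)"
  have search: "H_search d x z"
    using equation_bounds[OF assms] bounds by (intro H_search[rule_format]) auto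
  have zd: "2 * 2 \<le> z * d" using bounds by (intro mult_mono) auto
  have yf: "y * f = 1 + x * (d * z * w - z - w)"
    using eq by (simp add: f_def P_def algebra_simps)
  have wg: "w * g = 1 + z * (x * y - x - y)"
    using eq by (simp add: g_def P_def algebra_simps)
  have xw: "x * z \<le> x * ((z * d - 1) * w)"
    using mult_mono[of 1 "z * d - 1" z w] zd bounds by (intro mult_left_mono) auto
  have "d * z * w - z - w = (z * d - 1) * w - z" by (simp add: algebra_simps)
  then have "y * f > 0" unfolding yf using xw by (simp add: algebra_simps)
  then have f: "f > 0" using bounds by (simp add: zero_less_mult_iff)
  have "w * g > 0" unfolding wg using A bounds by (simp add: add_pos_nonneg)
  then have g: "g > 0" using bounds by (simp add: zero_less_mult_iff)
  have "P * w > 0" using f bounds unfolding f_def by (smt (verit) mult_nonneg_nonneg)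
  then have P: "P > 0" using bounds by (simp add: zero_less_mult_iff)
  have fg: "f * g = (x * z)\<^sup>2 + P"
  proof -
    \<comment> \<open>Multiplying by \<open>P\<close> replaces \<open>P * y\<close> and
      \<open>P * w\<close> by \<open>g\<close> and \<open>f\<close> up to constants, the usual
      factorisation of a bilinear equation.\<close>
    have "P * (y * f) = P * (1 + x * (d * z * w - z - w))" by (simp only: yf)
    moreover have "P * (x * (d * z * w - z - w)) = x * (z * d - 1) * (P * w) - P * x * z"
      by (simp add: algebra_simps)
    ultimately have "(g + x * (z * d - 1)) * f = P + x * (z * d - 1) * (f + z * (x - 1)) - P * x * z"
      unfolding g_def f_def by (simp add: algebra_simps)
    moreover have "x * (z * d - 1) * (z * (x - 1)) = (x * z) * (P + x * z)"
      by (simp add: P_def algebra_simps)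
    ultimately show ?thesis by (simp add: algebra_simps power2_eq_square)
  qed
  have "f \<le> x * z + d \<or> g \<le> x * z + d"
  proof (rule ccontr)
    assume "\<not> ?thesis"
    \<comment> \<open>The square exceeds \<open>(x * z)\<^sup>2\<close> by
      \<open>2 * x * z * d + d * d\<close>, but \<open>f * g\<close> exceeds it only by
      \<open>P \<le> x * z * d\<close>.\<close>
    then have "(x * z + d) * (x * z + d) \<le> f * g" using bounds f by (intro mult_mono) auto
    moreover have "1 \<le> x + (d * z + x * z)" using bounds by (simp add: add_increasing2)
    then have "P \<le> x * z * d" by (simp add: P_def algebra_simps)
    ultimately have "x * z * d + d * d \<le> 0" unfolding fg by (simp add: algebra_simps power2_eq_square)
    moreover have "0 < x * z * d + d * d" using bounds by (simp add: add_pos_pos)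
    ultimately show False by simp
  qed
  then show ?thesis
  proof
    assume "f \<le> x * z + d"
    then have "w * P \<le> x * z + d + z * (x - 1)" by (simp add: f_def algebra_simps)
    from zdiv_mono1[OF this P] have "w \<le> (x * z + d + z * (x - 1)) div P" using P by simp
    then have "H_test_w d x z P w" using search P bounds by (simp add: H_search_def P_def Let_def)
    moreover have "(1 + x * (d * z * w - z - w)) div f = y" using f unfolding yf[symmetric] by simp
    ultimately show ?thesis using bounds(3) yf by (simp add: H_test_w_def Let_def f_def)
  next
    assume "g \<le> x * z + d"
    then have "y * P \<le> x * z + d + x * (z * d - 1)" by (simp add: g_def algebra_simps)
    from zdiv_mono1[OF this P] have "y \<le> (x * z + d + x * (z * d - 1)) div P" using P by simp
    then have "H_test_y d x z P y" using search P bounds by (simp add: H_search_def P_def Let_def)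
    moreover have "(1 + z * (x * y - x - y)) div g = w" using g unfolding wg[symmetric] by simp
    ultimately show ?thesis using bounds(5) wg by (simp add: H_test_y_def Let_def g_def)
  qed
qed

lemma H_solutions_sound:
  "\<forall>(d, x, y, z, w)\<in>set H_solutions. 2 \<le> d \<and> 2 \<le> x \<and> x \<le> y \<and> 2 \<le> z \<and> z \<le> w \<and>
    x + y < x * y \<and> (x * y - x - y) * (d * z * w - z - w) = x * y * z * w + 1"
  by (simp add: H_solutions_def)

lemma card_H_solutions: "card (set H_solutions) = 39"
proof -
  have "distinct H_solutions" "length H_solutions = 39" by (simp_all add: H_solutions_def)
  then show ?thesis by (simp add: distinct_card)
qed

section \<open>Matching the matrices with the list\<close>

lemma H_matrix_in_H_matrices_iff:
  assumes "\<forall>j\<in>{1, 2, 5, 6}. b j \<ge> 2"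
  shows "H_matrix b \<in> H_matrices \<longleftrightarrow>
    b 1 * b 2 * b 3 - b 1 - b 2 > 0 \<and>
    (b 1 * b 2 * b 3 - b 1 - b 2) * (b 4 * b 5 * b 6 - b 5 - b 6) = b 1 * b 2 * b 5 * b 6 + 1"
proof -
  have "H_matrix b \<in> H_matrices \<longleftrightarrow>
      positive_definite (map_mat real_of_int (H_matrix b)) \<and> det (H_matrix b) = 1"
    using assms unfolding H_matrices_def by auto
  then show ?thesis
    using positive_definite_H_matrix_iff[OF assms] unfolding det_H_matrix by (auto simp: diff_eq_eq)
qed

definition solution_profile :: "int \<times> int \<times> int \<times> int \<times> int \<Rightarrow> (int \<times> int set) set" where
  "solution_profile = (\<lambda>(d, x, y, z, w). {(1, {x, y}), (d, {z, w})})"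

text \<open>As \<open>d \<ge> 2\<close>, the pair with first component 1 is recognisable;
  \<open>x \<le> y\<close> and \<open>z \<le> w\<close> then restore the order lost in the
  sets.\<close>

lemma inj_on_solution_profile: "inj_on solution_profile (set H_solutions)"
proof (rule inj_onI)
  fix s t
  assume st: "s \<in> set H_solutions" "t \<in> set H_solutions" "solution_profile s = solution_profile t"
  obtain d x y z w d' x' y' z' w' where eqs: "s = (d, x, y, z, w)" "t = (d', x', y', z', w')"
    by (cases s, cases t) auto
  have "2 \<le> d" "x \<le> y" "z \<le> w" "2 \<le> d'" "x' \<le> y'" "z' \<le> w'"
    using st(1,2) H_solutions_sound unfolding eqs by auto
  moreover have "{(1, {x, y}), (d, {z, w})} = {(1, {x', y'}), (d', {z', w'})}"
    using st(3) by (simp add: solution_profile_def eqs)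
  ultimately have "d = d'" "{x, y} = {x', y'}" "{z, w} = {z', w'}"
    by (auto simp: doubleton_eq_iff[of "(1, {x, y})"])
  with \<open>x \<le> y\<close> \<open>x' \<le> y'\<close> \<open>z \<le> w\<close> \<open>z' \<le> w'\<close>
  show "s = t" unfolding eqs
    by (auto simp: doubleton_eq_iff)
qed

text \<open>Two centre labels 1 make \<open>C * D\<close> at most \<open>x * y * z * w\<close>; two
  larger ones make it exceed that by 0 or by at least 4, never by 1.\<close>

lemma one_of_centres_eq_1:
  fixes x y c z w d :: int
  assumes "2 \<le> x" "2 \<le> y" "2 \<le> z" "2 \<le> w"
    and C: "x * y * c - x - y > 0"
    and eq: "(x * y * c - x - y) * (d * z * w - z - w) = x * y * z * w + 1"
  shows "c = 1 \<and> 2 \<le> d \<or> d = 1 \<and> 2 \<le> c"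
proof -
  define C D where "C = x * y * c - x - y" and "D = d * z * w - z - w"
  have CD: "C * D = (x * y) * (z * w) + 1" using eq by (simp add: C_def D_def)
  have sum_le: "p + q \<le> p * q" "4 \<le> p * q" if "2 \<le> p" "2 \<le> q" for p q :: int
  proof -
    have "0 \<le> (p - 2) * (q - 2)" using that by simp
    then show "p + q \<le> p * q" "4 \<le> p * q" using that by (simp_all add: algebra_simps)
  qed
  note xy = sum_le[OF assms(1,2)] and zw = sum_le[OF assms(3,4)]
  have XZ: "0 < (x * y) * (z * w)" using assms by simp
  \<comment> \<open>Since \<open>x + y \<le> x * y\<close>, the size of \<open>C\<close> relative to
    \<open>x * y\<close> is governed by \<open>c - 1\<close>; likewise for \<open>D\<close>.\<close>
  have C: "C = x * y * (c - 1) + (x * y - (x + y))" and D: "D = z * w * (d - 1) + (z * w - (z + w))"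
    by (simp_all add: C_def D_def algebra_simps)
  have "C > 0" using assms by (simp add: C_def)
  have "C * D > 0" using XZ unfolding CD by simp
  then have "D > 0" using \<open>C > 0\<close> by (simp add: zero_less_mult_iff)
  have "c \<ge> 1"
  proof (rule ccontr)
    assume "\<not> c \<ge> 1"
    then have "x * y * (c - 1) \<le> x * y * (- 1)" using xy by (intro mult_left_mono) auto
    then show False using \<open>C > 0\<close> assms(1,2) unfolding C by simp
  qed
  have "d \<ge> 1"
  proof (rule ccontr)
    assume "\<not> d \<ge> 1"
    then have "z * w * (d - 1) \<le> z * w * (- 1)" using zw by (intro mult_left_mono) auto
    then show False using \<open>D > 0\<close> assms(3,4) unfolding D by simp
  qed
  have "\<not> (c = 1 \<and> d = 1)"
  proof
    assume "c = 1 \<and> d = 1"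
    then have "C \<le> x * y" "D \<le> z * w" using assms(1-4) by (simp_all add: C D)
    then have "C * D \<le> (x * y) * (z * w)" using \<open>C > 0\<close> \<open>D > 0\<close> by (intro mult_mono) auto
    then show False unfolding CD by simp
  qed
  moreover have "\<not> (2 \<le> c \<and> 2 \<le> d)"
  proof
    assume "2 \<le> c \<and> 2 \<le> d"
    then have "x * y * 1 \<le> x * y * (c - 1)" "z * w * 1 \<le> z * w * (d - 1)"
      using xy zw by (intro mult_left_mono; simp)+
    then have *: "x * y \<le> C" "z * w \<le> D" using xy zw unfolding C D by simp_all
    define p q where "p = C - x * y" and "q = D - z * w"
    have "p \<ge> 0" "q \<ge> 0" using * by (simp_all add: p_def q_def)
    have 1: "(x * y) * q + (z * w) * p + p * q = 1"
      using CD by (simp add: p_def q_def algebra_simps)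
    have "4 * q \<le> (x * y) * q" "4 * p \<le> (z * w) * p"
      using xy zw \<open>p \<ge> 0\<close> \<open>q \<ge> 0\<close> by (simp_all add: mult_right_mono)
    moreover have "0 \<le> p * q" using \<open>p \<ge> 0\<close> \<open>q \<ge> 0\<close> by simp
    ultimately have "4 * q + 4 * p \<le> 1" unfolding 1[symmetric] by (simp only: add_mono add_increasing2)
    then have "p = 0" "q = 0" using \<open>p \<ge> 0\<close> \<open>q \<ge> 0\<close> by auto
    then show False using 1 by simp
  qed
  ultimately show ?thesis using \<open>c \<ge> 1\<close> \<open>d \<ge> 1\<close> by linarith
qed

text \<open>Sorting each leaf pair meets the ordering of the list and leaves the sets
  unchanged.\<close>

lemma solution_profile_of_equation:
  fixes d x y z w :: int
  assumes "2 \<le> d" "2 \<le> x" "2 \<le> y" "2 \<le> z" "2 \<le> w" "x + y < x * y"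
    and "(x * y - x - y) * (d * z * w - z - w) = x * y * z * w + 1"
  shows "{(1, {x, y}), (d, {z, w})} \<in> solution_profile ` set H_solutions"
proof -
  have "(d, min x y, max x y, min z w, max z w) \<in> set H_solutions"
    using assms by (intro equation_imp_H_solutions) (auto simp: min_def max_def algebra_simps)
  moreover have "{min x y, max x y} = {x, y}" "{min z w, max z w} = {z, w}"
    by (auto simp: min_def max_def)
  ultimately show ?thesis
    by (intro image_eqI) (auto simp: solution_profile_def)
qed

lemma profile_image_H_matrices: "profile ` H_matrices = solution_profile ` set H_solutions"
proof
  show "profile ` H_matrices \<subseteq> solution_profile ` set H_solutions"
  proof clarify
    fix A assume "A \<in> H_matrices"
    then obtain b where A: "A = H_matrix b" and leaves: "\<forall>j\<in>{1, 2, 5, 6}. b j \<ge> 2"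
      by (auto simp: H_matrices_def)
    with \<open>A \<in> H_matrices\<close> have C: "b 1 * b 2 * b 3 - b 1 - b 2 > 0"
      and eq: "(b 1 * b 2 * b 3 - b 1 - b 2) * (b 4 * b 5 * b 6 - b 5 - b 6) = b 1 * b 2 * b 5 * b 6 + 1"
      by (simp_all add: H_matrix_in_H_matrices_iff)
    \<comment> \<open>If vertex 4 is the centre with label 1, this inequality takes over the role of
      \<open>C\<close>.\<close>
    have D: "b 4 * b 5 * b 6 - b 5 - b 6 > 0"
    proof -
      have "b 1 * b 2 * b 5 * b 6 + 1 > 0" using leaves by (simp add: add_pos_pos)
      then show ?thesis using C unfolding eq[symmetric] by (simp add: zero_less_mult_iff)
    qed
    have "b 3 = 1 \<and> 2 \<le> b 4 \<or> b 4 = 1 \<and> 2 \<le> b 3"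
      using leaves C eq by (intro one_of_centres_eq_1) auto
    then show "profile A \<in> solution_profile ` set H_solutions"
    proof (elim disjE conjE)
      assume "b 3 = 1" "2 \<le> b 4"
      then show ?thesis
        using leaves C eq solution_profile_of_equation[of "b 4" "b 1" "b 2" "b 5" "b 6"]
        by (simp add: A profile_H_matrix)
    next
      assume "b 4 = 1" "2 \<le> b 3"
      then show ?thesis
        using leaves D eq solution_profile_of_equation[of "b 3" "b 5" "b 6" "b 1" "b 2"]
        by (simp add: A profile_H_matrix insert_commute algebra_simps)
    qed
  qed
next
  show "solution_profile ` set H_solutions \<subseteq> profile ` H_matrices"
  proof clarify
    fix d x y z w assume "(d, x, y, z, w) \<in> set H_solutions"
    with H_solutions_sound have s: "2 \<le> d" "2 \<le> x" "x \<le> y" "2 \<le> z" "z \<le> w" "x + y < x * y"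
      "(x * y - x - y) * (d * z * w - z - w) = x * y * z * w + 1"
      by auto
    \<comment> \<open>The leading 0 fills index 0, as vertices are numbered from 1.\<close>
    define b where "b = (!) [0, x, y, 1, d, z, w]"
    have b: "b 1 = x" "b 2 = y" "b 3 = 1" "b 4 = d" "b 5 = z" "b 6 = w"
      by (simp_all add: b_def)
    have "H_matrix b \<in> H_matrices"
      using s by (subst H_matrix_in_H_matrices_iff) (simp_all add: b del: One_nat_def)
    moreover have "profile (H_matrix b) = solution_profile (d, x, y, z, w)"
      by (simp only: profile_H_matrix solution_profile_def b prod.case)
    ultimately show "solution_profile (d, x, y, z, w) \<in> profile ` H_matrices"
      by (metis image_eqI)
  qed
qed

theorem theorem1p2:
  shows "card (H_matrices // H_equivalence) = 39"
proof -
  have E: "H_equivalence = {(A, B). A \<in> H_matrices \<and> B \<in> H_matrices \<and> profile A = profile B}"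
    using H_equivalence_iff by auto
  have "card (H_matrices // H_equivalence) = card (profile ` H_matrices)"
    unfolding E by (rule card_quotient_kernel)
  also have "\<dots> = card (set H_solutions)"
    by (simp only: profile_image_H_matrices card_image[OF inj_on_solution_profile])
  finally show ?thesis by (simp only: card_H_solutions)
qed

end
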